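(* Let $p\in(-\infty,-1]\cup[0,\infty)$. Then the inequality $$\frac{2+(1+3p)\cosh t}{3+p+2p\cosh t}<\frac{\sinh t}{t}$$ holds for all $t\in(0,\infty)$ if and only if $p\in(-\infty,-1]\cup\left[\frac19,\infty\right)$. The reversed inequality $$\frac{2+(1+3p)\cosh t}{3+p+2p\cosh t}>\frac{\sinh t}{t}$$ holds for all $t\in(0,\infty)$ if and only if $p=0$. *)

theory Defs imports Complex_Main begin
end

theory Submission
  imports Defs "HOL-Real_Asymp.Real_Asymp"
begin

text \<open>
  Write \<open>s = sinh t\<close> and \<open>c = cosh t\<close>.  For the admissible \<open>p\<close> the denominator
  \<open>3 + p + 2 p c\<close> has a constant sign: positive for \<open>p \<ge> 0\<close>, negative for \<open>p \<le> -1\<close>.  Clearing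
  denominators therefore reduces both inequalities to the sign of
  \<open>s (3 + p + 2 p c) - t (2 + (1 + 3 p) c) = A t + p B t\<close>, where
  \<open>A t = 3 s - t (2 + c)\<close> and \<open>B t = s (1 + 2 c) - 3 t c\<close>.  The point is that this is affine in \<open>p\<close>,
  so three inequalities decide every \<open>p\<close> at once: for all \<open>t > 0\<close>,
  \<open>A t < 0\<close> (the case \<open>p = 0\<close>, the hyperbolic Cusa inequality),
  \<open>B t > 0\<close> (the slope in \<open>p\<close>), and
  \<open>9 A t + B t > 0\<close> (the case \<open>p = 1/9\<close>).
  These settle the sufficiency of the conditions, and the case \<open>p \<le> -1\<close> follows from
  \<open>A t + p B t < 0\<close>.

  For the necessity, \<open>A t\<close> is asymptotic to \<open>- t^5 / 60\<close> and \<open>B t\<close> to \<open>9 t^5 / 60\<close> as \<open>t \<rightarrow> 0\<close>, so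
  \<open>A t + p B t\<close> is negative near \<open>0\<close> when \<open>p < 1/9\<close>; and \<open>B t\<close>, of order \<open>exp (2 t)\<close>, dominates
  \<open>A t\<close> as \<open>t \<rightarrow> \<infinity>\<close>, so \<open>A t + p B t\<close> is positive for large \<open>t\<close> when \<open>p > 0\<close>.
\<close>

definition cusa_gap :: "real \<Rightarrow> real" where
  "cusa_gap t = 3 * sinh t - t * (2 + cosh t)"

definition cusa_slope :: "real \<Rightarrow> real" where
  "cusa_slope t = sinh t * (1 + 2 * cosh t) - 3 * t * cosh t"

lemma pos_of_deriv_pos:
  fixes f f' :: "real \<Rightarrow> real"
  assumes "f 0 = 0"
    and deriv: "\<And>x. (f has_real_derivative f' x) (at x)"
    and pos: "\<And>x. x > 0 \<Longrightarrow> f' x > 0"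
    and "t > 0"
  shows "f t > 0"
proof -
  have "f 0 < f t"
  proof (rule DERIV_pos_imp_increasing_open[OF \<open>t > 0\<close>])
    show "\<exists>y. (f has_real_derivative y) (at x) \<and> y > 0" if "0 < x" "x < t" for x
      using deriv pos that by blast
    show "continuous_on {0..t} f"
      using deriv by (meson DERIV_isCont continuous_at_imp_continuous_on)
  qed
  with \<open>f 0 = 0\<close> show ?thesis by simp
qed

lemma cosh_gt_one: "t > 0 \<Longrightarrow> cosh t > 1" for t :: real
  using cosh_real_strict_mono[of 0 t] by simp

lemma sinh_gt_self: "t > 0 \<Longrightarrow> sinh t > t" for t :: real
  by (drule pos_of_deriv_pos[of "\<lambda>x. sinh x - x" "\<lambda>x. cosh x - 1", rotated -1])
     (auto intro!: derivative_eq_intros simp: cosh_gt_one)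

lemma sinh_less_mult_cosh: "t > 0 \<Longrightarrow> sinh t < t * cosh t" for t :: real
  by (drule pos_of_deriv_pos[of "\<lambda>x. x * cosh x - sinh x" "\<lambda>x. x * sinh x", rotated -1])
     (auto intro!: derivative_eq_intros)

text \<open>Two differentiations reduce the claim to \<open>t cosh t > sinh t\<close>.\<close>

lemma cusa_gap_neg:
  assumes "t > 0"
  shows "cusa_gap t < 0"
proof -
  have first: "x * sinh x + 2 - 2 * cosh x > 0" if "x > 0" for x :: real
    using that
    by (rule pos_of_deriv_pos[of "\<lambda>x. x * sinh x + 2 - 2 * cosh x"
          "\<lambda>x. x * cosh x - sinh x", rotated -1])
       (auto intro!: derivative_eq_intros simp: sinh_less_mult_cosh)
  have "t * (2 + cosh t) - 3 * sinh t > 0"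
    using assms
    by (rule pos_of_deriv_pos[of "\<lambda>x. x * (2 + cosh x) - 3 * sinh x"
          "\<lambda>x. x * sinh x + 2 - 2 * cosh x", rotated -1])
       (simp, auto intro!: derivative_eq_intros simp: algebra_simps dest: first)
  then show ?thesis by (simp add: cusa_gap_def)
qed

text \<open>
  The second derivative of the slope is \<open>8 s c - 5 s - 3 t c\<close>, which by \<open>t < s\<close> exceeds
  \<open>5 s (c - 1) > 0\<close>.
\<close>

lemma cusa_slope_pos:
  assumes "t > 0"
  shows "cusa_slope t > 0"
proof -
  have second: "8 * cosh x * sinh x - 5 * sinh x - 3 * x * cosh x > 0" if "x > 0" for x :: real
  proof -
    have "x * cosh x < sinh x * cosh x"
      using sinh_gt_self[OF that] by (simp add: mult_strict_right_mono)
    moreover have "5 * sinh x * (cosh x - 1) > 0"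
      using that cosh_gt_one[OF that] by simp
    ultimately show ?thesis by (simp only: algebra_simps)
  qed
  have first: "2 * (cosh x)\<^sup>2 + 2 * (sinh x)\<^sup>2 - 2 * cosh x - 3 * x * sinh x > 0" if "x > 0" for x :: real
    using that
    by (rule pos_of_deriv_pos[of
          "\<lambda>x. 2 * (cosh x)\<^sup>2 + 2 * (sinh x)\<^sup>2 - 2 * cosh x - 3 * x * sinh x"
          "\<lambda>x. 8 * cosh x * sinh x - 5 * sinh x - 3 * x * cosh x", rotated -1])
       (auto intro!: derivative_eq_intros simp: algebra_simps dest: second)
  show ?thesis
    using assms
    by (rule pos_of_deriv_pos[of cusa_slope
          "\<lambda>x. 2 * (cosh x)\<^sup>2 + 2 * (sinh x)\<^sup>2 - 2 * cosh x - 3 * x * sinh x", rotated -1])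
       (auto simp: cusa_slope_def[abs_def] power2_eq_square algebra_simps
             intro!: derivative_eq_intros dest: first)
qed

text \<open>
  The combination vanishing to order higher than five at the origin.  Its second derivative is
  \<open>4\<close> times the slope itself, so its positivity is inherited from the previous lemma.
\<close>

lemma cusa_critical_pos:
  assumes "t > 0"
  shows "9 * cusa_gap t + cusa_slope t > 0"
proof -
  have first: "16 * cosh x + 2 * (cosh x)\<^sup>2 + 2 * (sinh x)\<^sup>2 - 18 - 12 * x * sinh x > 0"
    if "x > 0" for x :: real
    using that
    by (rule pos_of_deriv_pos[of
          "\<lambda>x. 16 * cosh x + 2 * (cosh x)\<^sup>2 + 2 * (sinh x)\<^sup>2 - 18 - 12 * x * sinh x"
          "\<lambda>x. 4 * cusa_slope x", rotated -1])
       (auto intro!: derivative_eq_intros simp: cusa_slope_pos,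
        auto simp: cusa_slope_def algebra_simps)
  show ?thesis
    using assms
    by (rule pos_of_deriv_pos[of "\<lambda>x. 9 * cusa_gap x + cusa_slope x"
          "\<lambda>x. 16 * cosh x + 2 * (cosh x)\<^sup>2 + 2 * (sinh x)\<^sup>2 - 18 - 12 * x * sinh x", rotated -1])
       (auto simp: cusa_gap_def[abs_def] cusa_slope_def[abs_def] power2_eq_square algebra_simps
             intro!: derivative_eq_intros dest: first)
qed

text \<open>
  Both functions vanish to order five at the origin, so the sign near \<open>0\<close> is that of the
  leading coefficient \<open>(9 p - 1) / 60\<close>.
\<close>

lemma ex_neg_near_zero:
  assumes "p < 1/9"
  shows "\<exists>t>0. cusa_gap t + p * cusa_slope t < 0"
proof -
  have gap: "((\<lambda>t. cusa_gap t / t ^ 5) \<longlongrightarrow> - 1 / 60) (at_right 0)"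
    unfolding cusa_gap_def sinh_field_def cosh_field_def by real_asymp
  have slope: "((\<lambda>t. cusa_slope t / t ^ 5) \<longlongrightarrow> 9 / 60) (at_right 0)"
    unfolding cusa_slope_def sinh_field_def cosh_field_def by real_asymp
  have "((\<lambda>t. cusa_gap t / t ^ 5 + p * (cusa_slope t / t ^ 5)) \<longlongrightarrow> - 1 / 60 + p * (9 / 60))
          (at_right 0)"
    by (intro tendsto_intros gap slope)
  moreover have "- 1 / 60 + p * (9 / 60) < 0"
    using assms by simp
  ultimately have "\<forall>\<^sub>F t in at_right 0. cusa_gap t / t ^ 5 + p * (cusa_slope t / t ^ 5) < 0"
    by (rule order_tendstoD)
  moreover have "\<forall>\<^sub>F t::real in at_right 0. t > 0"
    by (rule eventually_at_right_less)
  ultimately have "\<forall>\<^sub>F t in at_right 0. t > 0 \<and> cusa_gap t + p * cusa_slope t < 0"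
    by eventually_elim (simp add: divide_simps)
  then show ?thesis
    using eventually_happens' trivial_limit_at_right_real by blast
qed

lemma ex_pos_near_infinity:
  assumes "p > 0"
  shows "\<exists>t>0. cusa_gap t + p * cusa_slope t > 0"
proof -
  have "\<forall>\<^sub>F t in at_top. cusa_gap t + p * cusa_slope t > 0"
    using assms unfolding cusa_gap_def cusa_slope_def sinh_field_def cosh_field_def by real_asymp
  then have "\<forall>\<^sub>F t in at_top. t > 0 \<and> cusa_gap t + p * cusa_slope t > 0"
    using eventually_gt_at_top[of 0] by eventually_elim simp
  then show ?thesis
    using eventually_happens' trivial_limit_at_top_linorder by blast
qed

lemma cusa_affine:
  "cusa_gap t + p * cusa_slope t
     = sinh t * (3 + p + 2 * p * cosh t) - t * (2 + (1 + 3 * p) * cosh t)"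
  by (simp add: cusa_gap_def cusa_slope_def algebra_simps)

lemma ratio_compare_nonneg:
  fixes p t :: real
  assumes "p \<ge> 0" "t > 0"
  shows "(2 + (1 + 3 * p) * cosh t) / (3 + p + 2 * p * cosh t) < sinh t / t
           \<longleftrightarrow> cusa_gap t + p * cusa_slope t > 0"
    and "(2 + (1 + 3 * p) * cosh t) / (3 + p + 2 * p * cosh t) > sinh t / t
           \<longleftrightarrow> cusa_gap t + p * cusa_slope t < 0"
proof -
  have "2 * p * cosh t \<ge> 0"
    using assms by simp
  then have denom: "3 + p + 2 * p * cosh t > 0"
    using assms by linarith
  show "(2 + (1 + 3 * p) * cosh t) / (3 + p + 2 * p * cosh t) < sinh t / t
           \<longleftrightarrow> cusa_gap t + p * cusa_slope t > 0"
    and "(2 + (1 + 3 * p) * cosh t) / (3 + p + 2 * p * cosh t) > sinh t / t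
           \<longleftrightarrow> cusa_gap t + p * cusa_slope t < 0"
    unfolding cusa_affine using denom \<open>t > 0\<close> by (simp_all add: pos_divide_less_eq
        pos_less_divide_eq mult.commute)
qed

text \<open>
  Here \<open>2 p cosh t < 2 p\<close>, so the denominator lies below \<open>3 + 3 p \<le> 0\<close>, and clearing it turns the
  inequality around.
\<close>

lemma ratio_less_of_le_minus_one:
  fixes p t :: real
  assumes "p \<le> -1" "t > 0"
  shows "(2 + (1 + 3 * p) * cosh t) / (3 + p + 2 * p * cosh t) < sinh t / t"
proof -
  have "p * cosh t < p * 1"
    using assms cosh_gt_one[of t] by (intro mult_strict_left_mono_neg) auto
  then have denom: "3 + p + 2 * p * cosh t < 0"
    using assms by linarith
  have "p * cusa_slope t \<le> 0"
    using assms cusa_slope_pos[of t] by (simp add: mult_nonpos_nonneg)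
  then have "cusa_gap t + p * cusa_slope t < 0"
    using cusa_gap_neg[OF \<open>t > 0\<close>] by linarith
  then have "t * (2 + (1 + 3 * p) * cosh t) > sinh t * (3 + p + 2 * p * cosh t)"
    unfolding cusa_affine by linarith
  then show ?thesis
    using denom \<open>t > 0\<close> by (simp add: neg_divide_less_eq pos_less_divide_eq mult.commute)
qed

theorem theorem7:
  fixes p :: real
  assumes "p \<in> {..-1} \<union> {0..}"
  shows "((\<forall>t\<in>{0<..}. (2 + (1 + 3 * p) * cosh t) / (3 + p + 2 * p * cosh t) < sinh t / t)
            \<longleftrightarrow> p \<in> {..-1} \<union> {1/9..})
       \<and> ((\<forall>t\<in>{0<..}. (2 + (1 + 3 * p) * cosh t) / (3 + p + 2 * p * cosh t) > sinh t / t)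
            \<longleftrightarrow> p = 0)"
proof (cases "p \<le> -1")
  case True
  then have less: "(2 + (1 + 3 * p) * cosh t) / (3 + p + 2 * p * cosh t) < sinh t / t"
    if "t > 0" for t :: real
    using ratio_less_of_le_minus_one that by blast
  then have "\<not> (\<forall>t\<in>{0<..}. (2 + (1 + 3 * p) * cosh t) / (3 + p + 2 * p * cosh t) > sinh t / t)"
    by (metis less greaterThan_iff less_asym zero_less_one)
  with True less show ?thesis by auto
next
  case False
  with assms have "p \<ge> 0" by auto
  have "(\<forall>t>0. cusa_gap t + p * cusa_slope t > 0) \<longleftrightarrow> p \<ge> 1/9"
  proof
    assume "\<forall>t>0. cusa_gap t + p * cusa_slope t > 0"
    then show "p \<ge> 1/9"
      using ex_neg_near_zero[of p] by (meson not_less less_asym)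
  next
    assume p: "p \<ge> 1/9"
    show "\<forall>t>0. cusa_gap t + p * cusa_slope t > 0"
    proof (intro allI impI)
      fix t :: real
      assume "t > 0"
      have "1/9 * cusa_slope t \<le> p * cusa_slope t"
        using p cusa_slope_pos[OF \<open>t > 0\<close>] by (intro mult_right_mono) auto
      then show "cusa_gap t + p * cusa_slope t > 0"
        using cusa_critical_pos[OF \<open>t > 0\<close>] by linarith
    qed
  qed
  moreover have "(\<forall>t>0. cusa_gap t + p * cusa_slope t < 0) \<longleftrightarrow> p = 0"
  proof
    assume "\<forall>t>0. cusa_gap t + p * cusa_slope t < 0"
    then show "p = 0"
      using ex_pos_near_infinity[of p] \<open>p \<ge> 0\<close> by (metis less_asym order_le_less)
  next
    assume "p = 0"
    then show "\<forall>t>0. cusa_gap t + p * cusa_slope t < 0"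
      using cusa_gap_neg by simp
  qed
  ultimately show ?thesis
    using ratio_compare_nonneg[OF \<open>p \<ge> 0\<close>] False by auto
qed

end
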